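(* Let $(Z_n)_{n\ge 0}$ be a branching process in random environment with linear fractional offspring distributions, started from $Z_0=1$. Assume that $$0<\mathbb{E}\big[Xe^{-X}\big]<\infty$$ and that $\mathbf{E}\big[\log(1-Q(0))\big]>-\infty$, and set $\gamma:=\mathbb{E}[e^{-X}]$ (which is finite). Then there is a constant $\vartheta>0$ such that, as $n\to\infty$, $$\mathbb{P}(Z_n=1)\sim \vartheta\,\gamma^n .$$
   Context: Let $\Delta$ be the space of probability distributions on $\mathbb{N}_0=\{0,1,2,\dots\}$; for $q\in\Delta$ write $q(y):=q(\{y\})$ and $m(q):=\sum_{y\ge 0} y\,q(y)$. Let $Q$ be a $\Delta$-valued random variable. Throughout, $Q$ is a.s. linear fractional: $Q(0)=a$ and $Q(k)=\frac{(1-a)(1-p)}{p}p^k$ for $k\ge 1$, where $a\in[0,1)$ and $p\in(0,1)$ are random parameters. A random environment is an i.i.d. sequence $\Pi=(Q_1,Q_2,\dots)$ of copies of $Q$. The branching process $(Z_n)_{n\ge0}$ in the environment $\Pi$: $Z_0$ is independent of $\Pi$ and, given $\Pi$, $(Z_n)$ is a Markov chain with $\mathcal{L}(Z_n\mid Z_{n-1}=z,\Pi=(q_1,q_2,\dots))=q_n^{*z}$ ($z$-fold convolution). $\mathbb{P}$ denotes the law with $Z_0=1$. Let $X:=\log m(Q)$. The process is supercritical, i.e. $\mathbb{E}[X]>0$. Change of measure: with $\gamma:=\mathbb{E}[e^{-X}]$, $\mathbf{P}$ (with expectation $\mathbf{E}$) is the measure determined by $\mathbf{E}[\phi(Q)]:=\gamma^{-1}\mathbb{E}[e^{-X}\phi(Q)]$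 for bounded measurable $\phi:\Delta\to\mathbb{R}$; under $\mathbf{P}$ the environment $Q_1,Q_2,\dots$ is i.i.d. with this tilted law, and the conditional law of $(Z_n)$ given $\Pi$ is unchanged. $a_n\sim b_n$ means $a_n/b_n\to1$. *)

theory Defs
  imports "HOL-Probability.Probability"
begin

text \<open>The space \<open>\<Delta>\<close> of probability distributions on the natural numbers is the type
  \<^typ>\<open>nat pmf\<close>. Its \<open>\<sigma>\<close>-algebra is the one of the Giry monad, that is, the one generated by
  the evaluations \<open>q \<mapsto> q(A)\<close>; on this countable base it is also the Borel \<open>\<sigma>\<close>-algebra of the
  total variation metric.\<close>

definition Delta :: "nat pmf measure" where
  "Delta = vimage_algebra UNIV measure_pmf (prob_algebra (count_space UNIV))"

definition offspring_mean :: "nat pmf \<Rightarrow> real" where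
  "offspring_mean q = (\<Sum>y. real y * pmf q y)"

text \<open>Both \<^const>\<open>suminf\<close> and \<^const>\<open>ln\<close> are total. Linear fractional laws have a finite and
  strictly positive mean, so for them no default value is involved.\<close>

definition log_mean :: "nat pmf \<Rightarrow> real" where
  "log_mean q = ln (offspring_mean q)"

definition linear_fractional :: "nat pmf \<Rightarrow> bool" where
  "linear_fractional q \<longleftrightarrow>
     (\<exists>a p. 0 \<le> a \<and> a < 1 \<and> 0 < p \<and> p < 1 \<and> pmf q 0 = a \<and>
        (\<forall>k\<ge>1. pmf q k = (1 - a) * (1 - p) / p * p ^ k))"

definition conv_power :: "nat pmf \<Rightarrow> nat \<Rightarrow> nat pmf" where
  "conv_power q z = map_pmf sum_list (replicate_pmf z q)"

text \<open>The environment is \<open>E 1, E 2, \<dots>\<close>; the value \<open>E 0\<close> is not used.\<close>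

definition environment :: "(nat \<Rightarrow> 'w \<Rightarrow> nat pmf) \<Rightarrow> 'w \<Rightarrow> nat \<Rightarrow> nat pmf" where
  "environment E \<omega> = (\<lambda>i\<in>{1..}. E i \<omega>)"

abbreviation env_space :: "(nat \<Rightarrow> nat pmf) measure" where
  "env_space \<equiv> (\<Pi>\<^sub>M i\<in>{1..}. Delta)"

text \<open>The \<open>\<sigma>\<close>-algebra generated by the whole environment and \<open>Z 0, \<dots>, Z n\<close>.\<close>

definition history ::
  "'w measure \<Rightarrow> (nat \<Rightarrow> 'w \<Rightarrow> nat pmf) \<Rightarrow> (nat \<Rightarrow> 'w \<Rightarrow> nat) \<Rightarrow> nat \<Rightarrow> 'w measure" where
  "history M E Z n =
     vimage_algebra (space M) (\<lambda>\<omega>. (environment E \<omega>, \<lambda>i\<in>{..n}. Z i \<omega>))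
       (env_space \<Otimes>\<^sub>M (\<Pi>\<^sub>M i\<in>{..n}. count_space UNIV))"

text \<open>\<open>Q\<close> is the generic offspring law, of which \<open>E 1, E 2, \<dots>\<close> are i.i.d. copies. That \<open>Z\<close>
  is, given the environment, a Markov chain with transition law \<open>z \<mapsto> conv_power (E (n + 1)) z\<close>
  at step \<open>n + 1\<close> is expressed by conditioning on the environment together with the past of
  \<open>Z\<close>. Independence of \<open>Z 0\<close> and the environment is stated for the generated
  \<open>\<sigma>\<close>-algebras because \<open>indep_var\<close> needs both variables to have the same type.\<close>

locale branching_process_random_env = prob_space M
  for M :: "'w measure" +
  fixes Q :: "'w \<Rightarrow> nat pmf"
    and E :: "nat \<Rightarrow> 'w \<Rightarrow> nat pmf"
    and Z :: "nat \<Rightarrow> 'w \<Rightarrow> nat"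
  assumes Q_measurable: "Q \<in> M \<rightarrow>\<^sub>M Delta"
    and env_indep: "indep_vars (\<lambda>_. Delta) E {1..}"
    and env_copies: "\<And>n. n \<ge> 1 \<Longrightarrow> distr M Delta (E n) = distr M Delta Q"
    and Z_measurable: "\<And>n. Z n \<in> M \<rightarrow>\<^sub>M count_space UNIV"
    and Z0_indep: "indep_set (sets (vimage_algebra (space M) (Z 0) (count_space UNIV)))
        (sets (vimage_algebra (space M) (environment E) env_space))"
    and transition: "\<And>n k. AE \<omega> in M.
        real_cond_exp M (history M E Z n) (indicator {\<omega> \<in> space M. Z (Suc n) \<omega> = k}) \<omega>
          = pmf (conv_power (E (Suc n) \<omega>) (Z n \<omega>)) k"

definition gamma_env :: "'w measure \<Rightarrow> ('w \<Rightarrow> nat pmf) \<Rightarrow> real" where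
  "gamma_env M Q = (\<integral>\<omega>. exp (- log_mean (Q \<omega>)) \<partial>M)"

text \<open>The expectation of \<open>\<phi> \<circ> Q\<close> under this measure is \<open>1 / \<gamma>\<close> times the expectation
  of \<open>exp (- X) * \<phi> \<circ> Q\<close> under \<open>M\<close>, where \<open>X = log_mean \<circ> Q\<close>.\<close>

definition tilted :: "'w measure \<Rightarrow> ('w \<Rightarrow> nat pmf) \<Rightarrow> 'w measure" where
  "tilted M Q = density M (\<lambda>\<omega>. ennreal (exp (- log_mean (Q \<omega>)) / gamma_env M Q))"

text \<open>\<open>E[X] > 0\<close> as a statement about a possibly infinite expectation: \<open>E[X\<^sup>-] < E[X\<^sup>+]\<close>, which
  forces \<open>E[X\<^sup>-]\<close> to be finite and allows \<open>E[X] = \<infinity>\<close> (\<^const>\<open>ennreal\<close> maps negative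
  reals to \<open>0\<close>).\<close>

definition supercritical :: "'w measure \<Rightarrow> ('w \<Rightarrow> nat pmf) \<Rightarrow> bool" where
  "supercritical M Q \<longleftrightarrow>
     (\<integral>\<^sup>+\<omega>. ennreal (- log_mean (Q \<omega>)) \<partial>M) < (\<integral>\<^sup>+\<omega>. ennreal (log_mean (Q \<omega>)) \<partial>M)"

end

theory Submission
  imports Defs
begin

text \<open>
  A linear fractional law \<open>q\<close> has a generating function \<open>f\<close> for which \<open>1 / (1 - f s)\<close> is an affine
  function of \<open>1 / (1 - s)\<close>, with slope \<open>1 / m(q) = exp (- X)\<close> and value \<open>1 / (1 - q(0))\<close> at the
  point \<open>1\<close>. In the coordinate \<open>w = 1 / (1 - s)\<close> the composition of generating functions, that is, the
  generation law in a fixed environment, is a composition of affine maps. Its slope is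
  \<open>exp (- S\<^sub>n)\<close>, where \<open>S\<^sub>n\<close> is the sum of the first \<open>n\<close> log means; write \<open>W\<^sub>n\<close> for its value at \<open>1\<close>.
  Differentiating the generating function at \<open>s = 0\<close> shows that the conditional probability of
  \<open>Z\<^sub>n = 1\<close> is \<open>exp (- S\<^sub>n) / W\<^sub>n\<^sup>2\<close> (\<open>pmf_quenched_law_1\<close>).

  The factor \<open>exp (- S\<^sub>n)\<close> is the density of the change of measure up to \<open>\<gamma>\<^sup>n\<close>, so the probability
  of \<open>Z\<^sub>n = 1\<close> is \<open>\<gamma>\<^sup>n\<close> times the tilted expectation of \<open>W\<^sub>n\<^sup>-\<^sup>2\<close>. As the environment is i.i.d., this
  expectation is the \<open>n\<close>-th iterate of the transfer operator \<open>f \<mapsto> (w \<mapsto> \<^bold>E[f(g\<^sub>Q(w))])\<close>, applied to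
  \<open>w\<^sup>-\<^sup>2\<close> and evaluated at \<open>1\<close>; here \<open>g\<^sub>Q\<close> is the affine map of \<open>Q\<close> (\<open>nn_integral_PiM_lf_comp\<close>).
  All these maps are increasing and keep \<open>[1, \<infinity>)\<close> invariant, so the iterates decrease
  (\<open>decseq_funpow_lf_op\<close>) and converge. What has to be shown is that the limit is not \<open>0\<close>.

  If it were \<open>0\<close>, then \<open>W\<^sub>n\<close> would tend to infinity in probability. But far out the map \<open>g\<^sub>Q\<close> multiplies
  by about \<open>exp (- X)\<close>, so there \<open>ln W\<close> has drift \<open>- \<^bold>E[X] < 0\<close>. Because the increment
  \<open>ln (g\<^sub>Q(w) / w)\<close> lies between \<open>- X\<close> and \<open>- ln (1 - Q(0))\<close>, both integrable, dominated convergence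
  makes this precise: for some \<open>\<delta> > 0\<close> and \<open>C\<close>, the expected increment of \<open>ln\<close> at \<open>w\<close> is at most
  \<open>- \<delta> + C / w\<^sup>2\<close> (\<open>drift_inequality\<close>). Summing over the steps and using \<open>ln W\<^sub>n \<ge> 0\<close> gives
  \<open>n \<delta> \<le> C (\<^bold>E[W\<^sub>0\<^sup>-\<^sup>2] + \<dots> + \<^bold>E[W\<^sub>n\<^sub>-\<^sub>1\<^sup>-\<^sup>2])\<close>, which is impossible when the summands tend to \<open>0\<close>.
\<close>

section \<open>Probability generating functions\<close>

definition pgf :: "nat pmf \<Rightarrow> real \<Rightarrow> real" where
  "pgf q s = measure_pmf.expectation q (\<lambda>k. s ^ k)"

lemma integrable_power_pmf:
  fixes s :: real
  assumes "0 \<le> s" "s \<le> 1"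
  shows "integrable (measure_pmf q) (\<lambda>k. s ^ k)"
  by (rule measure_pmf.integrable_const_bound[where B = 1])
    (use assms in \<open>auto simp: power_le_one\<close>)

lemma pgf_sums:
  assumes "0 \<le> s" "s \<le> 1"
  shows "(\<lambda>k. pmf q k * s ^ k) sums pgf q s"
proof -
  have "integrable (density (count_space UNIV) (\<lambda>k. ennreal (pmf q k))) (\<lambda>k. s ^ k)"
    using integrable_power_pmf[OF assms] unfolding measure_pmf_eq_density .
  then have "integrable (count_space UNIV) (\<lambda>k. pmf q k * s ^ k)"
    by (simp add: integrable_density)
  then have "(\<lambda>k. pmf q k * s ^ k) sums (\<integral>k. pmf q k * s ^ k \<partial>count_space UNIV)"
    by (rule sums_integral_count_space_nat)
  also have "(\<integral>k. pmf q k * s ^ k \<partial>count_space UNIV) = pgf q s"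
    by (simp add: pgf_def measure_pmf_eq_density integral_density)
  finally show ?thesis .
qed

lemma pgf_bind_pmf:
  assumes "0 \<le> s" "s \<le> 1"
  shows "pgf (bind_pmf r f) s = measure_pmf.expectation r (\<lambda>x. pgf (f x) s)"
  unfolding pgf_def measure_pmf_bind
proof (rule integral_bind[where K = "count_space UNIV" and B = 1 and B' = 1])
  show "finite_measure (measure_pmf r)" by unfold_locales
qed (use assms measurable_space[OF measurable_measure_pmf[of f]] in
    \<open>auto simp: power_le_one measure_pmf.emeasure_space_1\<close>)

lemma conv_power_0: "conv_power q 0 = return_pmf 0"
  by (simp add: conv_power_def)

lemma conv_power_Suc:
  "conv_power q (Suc z) = bind_pmf q (\<lambda>x. map_pmf (\<lambda>y. x + y) (conv_power q z))"
  by (simp add: conv_power_def map_bind_pmf map_pmf_def bind_assoc_pmf bind_return_pmf)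

lemma pgf_conv_power:
  assumes "0 \<le> s" "s \<le> 1"
  shows "pgf (conv_power q z) s = pgf q s ^ z"
proof (induction z)
  case 0
  show ?case by (simp add: conv_power_0 pgf_def)
next
  case (Suc z)
  have "pgf (map_pmf (\<lambda>y. x + y) (conv_power q z)) s = s ^ x * pgf q s ^ z" for x
    using Suc by (simp add: pgf_def power_add)
  then show ?case
    by (simp add: conv_power_Suc pgf_bind_pmf assms) (simp add: pgf_def)
qed

text \<open>The weight at \<open>1\<close> is the linear coefficient of the power series. The closed form \<open>g\<close> is only known on
  \<open>[0, 1)\<close>, hence the two derivatives are compared as one-sided derivatives at \<open>0\<close>.\<close>

lemma pmf_1_eq_pgf_derivative:
  assumes D: "(g has_field_derivative d) (at 0)"
    and eq: "\<And>s. 0 \<le> s \<Longrightarrow> s < 1 \<Longrightarrow> pgf q s = g s"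
  shows "pmf q 1 = d"
proof -
  define G where "G s = (\<Sum>k. pmf q k * s ^ k)" for s :: real
  have sm: "summable (\<lambda>k. pmf q k * (1/2::real) ^ k)"
    using pgf_sums[of "1/2" q] by (auto simp: sums_iff)
  have "DERIV G 0 :> (\<Sum>k. diffs (pmf q) k * 0 ^ k)"
    unfolding G_def by (rule termdiffs_strong[OF sm]) simp
  moreover have "(\<Sum>k. diffs (pmf q) k * 0 ^ k) = pmf q 1"
    by (simp add: diffs_def)
  ultimately have "(G has_field_derivative pmf q 1) (at 0 within {0..})"
    by (metis has_field_derivative_at_within)
  moreover have "(G has_field_derivative d) (at 0 within {0..})"
  proof (rule has_field_derivative_transform_within[OF has_field_derivative_at_within[OF D], of 1])
    fix s :: real assume "s \<in> {0..}" "dist s 0 < 1"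
    then show "g s = G s" using eq[of s] pgf_sums[of s q] by (auto simp: G_def sums_iff)
  qed auto
  moreover have "at (0::real) within {0..} \<noteq> bot"
    by (simp add: at_within_Ici_at_right)
  ultimately show ?thesis
    using has_field_derivative_unique by blast
qed

section \<open>Linear fractional laws as affine maps\<close>

text \<open>The generating function in the coordinate \<open>w = 1 / (1 - s)\<close>; the fixed point \<open>s = 1\<close> lies at infinity,
  and \<open>s = 0\<close> is \<open>w = 1\<close>.\<close>

definition lf_map :: "nat pmf \<Rightarrow> real \<Rightarrow> real" where
  "lf_map q w = exp (- log_mean q) * (w - 1) + 1 / (1 - pmf q 0)"

text \<open>The innermost map is the one of the last generation, since a generating function of generation \<open>n\<close> is
  \<open>f\<^sub>1 \<circ> \<dots> \<circ> f\<^sub>n\<close>. In particular \<open>lf_comp e n 1\<close> is the reciprocal of the survival probability up to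
  generation \<open>n\<close> in the environment \<open>e\<close>.\<close>

primrec lf_comp :: "(nat \<Rightarrow> nat pmf) \<Rightarrow> nat \<Rightarrow> real \<Rightarrow> real" where
  "lf_comp e 0 w = w"
| "lf_comp e (Suc n) w = lf_comp e n (lf_map (e (Suc n)) w)"

definition lf_slope :: "(nat \<Rightarrow> nat pmf) \<Rightarrow> nat \<Rightarrow> real" where
  "lf_slope e n = (\<Prod>i=1..n. exp (- log_mean (e i)))"

text \<open>The weights from \<open>1\<close> on are \<open>(1 - a) (1 - p) p\<^sup>k\<^sup>-\<^sup>1\<close>, so the mean is the derivative of a geometric series
  and equals \<open>(1 - a) / (1 - p)\<close>.\<close>

lemma linear_fractionalE:
  assumes "linear_fractional q"
  obtains a p where "0 \<le> a" "a < 1" "0 < p" "p < 1" "pmf q 0 = a"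
    "\<And>k. k \<ge> 1 \<Longrightarrow> pmf q k = (1 - a) * (1 - p) / p * p ^ k"
    "exp (- log_mean q) = (1 - p) / (1 - a)"
proof -
  obtain a p where *: "0 \<le> a" "a < 1" "0 < p" "p < 1" "pmf q 0 = a"
    "\<And>k. k \<ge> 1 \<Longrightarrow> pmf q k = (1 - a) * (1 - p) / p * p ^ k"
    using assms unfolding linear_fractional_def by blast
  have Suc: "pmf q (Suc k) = (1 - a) * (1 - p) * p ^ k" for k
    using *(3) *(6)[of "Suc k"] by simp
  have "(\<lambda>k. (1 - a) * (1 - p) * (real (Suc k) * p ^ k)) sums ((1 - a) * (1 - p) * (1 / (1 - p)\<^sup>2))"
    using geometric_deriv_sums[of p] * by (intro sums_mult) auto
  then have "(\<lambda>k. real (Suc k) * pmf q (Suc k)) sums ((1 - a) * (1 - p) * (1 / (1 - p)\<^sup>2))"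
    by (rule sums_cong[THEN iffD1, rotated]) (simp add: Suc power_mult_distrib)
  then have "(\<lambda>k. real k * pmf q k) sums ((1 - a) / (1 - p))"
    using * by (subst (asm) sums_Suc_iff) (simp add: power2_eq_square)
  then have "offspring_mean q = (1 - a) / (1 - p)"
    by (simp add: offspring_mean_def sums_iff)
  then have "exp (- log_mean q) = (1 - p) / (1 - a)"
    using * by (simp add: log_mean_def exp_minus)
  with * show ?thesis by (rule that)
qed

lemma pgf_linear_fractional:
  assumes "linear_fractional q" "0 \<le> s" "s < 1"
  shows "pgf q s = 1 - 1 / lf_map q (1 / (1 - s))"
proof -
  obtain a p where *: "0 \<le> a" "a < 1" "0 < p" "p < 1" "pmf q 0 = a"
    "\<And>k. k \<ge> 1 \<Longrightarrow> pmf q k = (1 - a) * (1 - p) / p * p ^ k"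
    "exp (- log_mean q) = (1 - p) / (1 - a)"
    using assms by (auto elim: linear_fractionalE)
  have Suc: "pmf q (Suc k) = (1 - a) * (1 - p) * p ^ k" for k
    using *(3) *(6)[of "Suc k"] by simp
  have ps: "0 \<le> p * s" "p * s < 1"
    using * assms mult_strict_mono[of p 1 s 1] by auto
  have "(\<lambda>k. (1 - a) * (1 - p) * s * (p * s) ^ k) sums ((1 - a) * (1 - p) * s * (1 / (1 - p * s)))"
    using geometric_sums[of "p * s"] ps by (intro sums_mult) auto
  then have "(\<lambda>k. pmf q (Suc k) * s ^ Suc k) sums ((1 - a) * (1 - p) * s * (1 / (1 - p * s)))"
    by (rule sums_cong[THEN iffD1, rotated]) (simp add: Suc power_mult_distrib)
  then have "(\<lambda>k. pmf q k * s ^ k) sums ((1 - a) * (1 - p) * s * (1 / (1 - p * s)) + a)"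
    using * by (subst (asm) sums_Suc_iff) simp
  then have "pgf q s = (1 - a) * (1 - p) * s * (1 / (1 - p * s)) + a"
    using pgf_sums[of s q] assms sums_unique2 by auto
  also have "\<dots> = 1 - (1 - a) * (1 - s) / (1 - p * s)"
    using ps by (simp add: field_simps)
  also have "(1 - a) * (1 - s) / (1 - p * s) = 1 / lf_map q (1 / (1 - s))"
  proof -
    have "1 / (1 - s) - 1 = s / (1 - s)"
      using assms by (simp add: field_simps)
    then have "lf_map q (1 / (1 - s)) = (1 - p) / (1 - a) * (s / (1 - s)) + 1 / (1 - a)"
      using * unfolding lf_map_def by simp
    also have "\<dots> = (1 - p * s) / ((1 - a) * (1 - s))"
      using * assms by (simp add: divide_simps) (simp add: algebra_simps)
    finally show ?thesis by simp
  qed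
  finally show ?thesis .
qed

lemma lf_map_mono: "v \<le> w \<Longrightarrow> lf_map q v \<le> lf_map q w"
  by (simp add: lf_map_def)

lemma lf_map_ge_1:
  assumes "linear_fractional q" "1 \<le> w"
  shows "1 \<le> lf_map q w"
proof -
  have "1 \<le> 1 / (1 - pmf q 0)"
    using assms(1) by (auto elim!: linear_fractionalE)
  moreover have "0 \<le> exp (- log_mean q) * (w - 1)"
    using assms(2) by simp
  ultimately show ?thesis
    unfolding lf_map_def by linarith
qed

text \<open>Writing \<open>lf_map q w = exp (- log_mean q) * w + \<kappa>\<close>, the ratio to \<open>w\<close> is \<open>exp (- log_mean q) + \<kappa> / w\<close>, and
  \<open>\<kappa> = p / (1 - a)\<close> is positive. The two bounds are the values at \<open>w = \<infinity>\<close> and \<open>w = 1\<close>; their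
  logarithms bound the logarithm of the ratio uniformly in \<open>w\<close>.\<close>

lemma lf_map_divide:
  assumes "linear_fractional q" "1 \<le> w"
  shows "exp (- log_mean q) \<le> lf_map q w / w" "lf_map q w / w \<le> 1 / (1 - pmf q 0)"
    "w \<le> v \<Longrightarrow> lf_map q v / v \<le> lf_map q w / w"
proof -
  define \<kappa> where "\<kappa> = 1 / (1 - pmf q 0) - exp (- log_mean q)"
  have \<kappa>: "0 \<le> \<kappa>"
    using assms(1) by (auto elim!: linear_fractionalE simp: \<kappa>_def divide_right_mono)
  have eq: "lf_map q u / u = exp (- log_mean q) + \<kappa> / u" if "1 \<le> u" for u
    using that by (simp add: lf_map_def \<kappa>_def field_simps)
  show "exp (- log_mean q) \<le> lf_map q w / w"
    using \<kappa> assms(2) by (simp add: eq)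
  have "\<kappa> / w \<le> \<kappa>"
    using \<kappa> assms(2) by (simp add: divide_le_eq mult_left_mono[of 1 w \<kappa>, simplified])
  then show "lf_map q w / w \<le> 1 / (1 - pmf q 0)"
    using assms(2) by (simp add: eq) (simp add: \<kappa>_def)
  show "lf_map q v / v \<le> lf_map q w / w" if "w \<le> v"
    using \<kappa> assms(2) that by (simp add: eq frac_le)
qed

lemma lf_comp_affine: "lf_comp e n w = lf_slope e n * (w - 1) + lf_comp e n 1"
proof (induction n arbitrary: w)
  case 0
  show ?case by (simp add: lf_slope_def)
next
  case (Suc n)
  show ?case
    by (simp add: Suc[of "lf_map (e (Suc n)) w"] Suc[of "lf_map (e (Suc n)) 1"])
      (simp add: lf_map_def lf_slope_def algebra_simps)
qed

lemma lf_slope_pos: "0 < lf_slope e n"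
  by (simp add: lf_slope_def prod_pos)

lemma lf_comp_cong: "(\<And>i. i \<in> {1..n} \<Longrightarrow> e i = e' i) \<Longrightarrow> lf_comp e n w = lf_comp e' n w"
  by (induction n arbitrary: w) auto

lemma lf_slope_cong: "(\<And>i. i \<in> {1..n} \<Longrightarrow> e i = e' i) \<Longrightarrow> lf_slope e n = lf_slope e' n"
  unfolding lf_slope_def by (rule prod.cong) auto

lemma lf_comp_ge_1:
  assumes "\<And>i. i \<in> {1..n} \<Longrightarrow> linear_fractional (e i)" "1 \<le> w"
  shows "1 \<le> lf_comp e n w"
  using assms
proof (induction n arbitrary: w)
  case (Suc n)
  have "1 \<le> lf_map (e (Suc n)) w"
    using Suc.prems by (intro lf_map_ge_1) auto
  then show ?case
    using Suc by simp
qed simp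

section \<open>The law of a generation in a fixed environment\<close>

text \<open>The conditional law of \<open>Z\<^sub>n\<close> when the environment is \<open>e\<close> and \<open>Z\<^sub>0 = 1\<close>.\<close>

primrec quenched_law :: "(nat \<Rightarrow> nat pmf) \<Rightarrow> nat \<Rightarrow> nat pmf" where
  "quenched_law e 0 = return_pmf 1"
| "quenched_law e (Suc n) = bind_pmf (quenched_law e n) (conv_power (e (Suc n)))"

text \<open>Summing over the size of generation \<open>n\<close> replaces the argument \<open>s\<close> by \<open>t\<close>, the value at \<open>s\<close> of the
  generating function of the last offspring law; this composition is a composition of affine maps in the
  reciprocal coordinate.\<close>

lemma pgf_quenched_law:
  assumes "\<And>i. i \<in> {1..n} \<Longrightarrow> linear_fractional (e i)" "0 \<le> s" "s < 1"
  shows "pgf (quenched_law e n) s = 1 - 1 / lf_comp e n (1 / (1 - s))"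
  using assms
proof (induction n arbitrary: s)
  case 0
  then show ?case by (simp add: pgf_def)
next
  case (Suc n)
  define t where "t = pgf (e (Suc n)) s"
  have lf: "linear_fractional (e (Suc n))"
    using Suc.prems by simp
  have t: "t = 1 - 1 / lf_map (e (Suc n)) (1 / (1 - s))"
    unfolding t_def by (rule pgf_linear_fractional) (use Suc.prems lf in auto)
  have "1 \<le> lf_map (e (Suc n)) (1 / (1 - s))"
    using Suc.prems lf by (intro lf_map_ge_1) auto
  then have "0 \<le> t" "t < 1" "1 / (1 - t) = lf_map (e (Suc n)) (1 / (1 - s))"
    by (auto simp: t)
  moreover have "pgf (quenched_law e (Suc n)) s = pgf (quenched_law e n) t"
    using Suc.prems by (simp add: pgf_bind_pmf pgf_conv_power t_def pgf_def[of "quenched_law e n"])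
  ultimately show ?case
    using Suc.IH[of t] Suc.prems by simp
qed

text \<open>Write \<open>u\<close> for the slope and \<open>W\<close> for the value at \<open>1\<close> of the composed map. The generating function is
  \<open>1 - 1 / (u s / (1 - s) + W)\<close>, and its derivative at \<open>0\<close> is \<open>u / W\<^sup>2\<close>.\<close>

lemma pmf_quenched_law_1:
  assumes "\<And>i. i \<in> {1..n} \<Longrightarrow> linear_fractional (e i)"
  shows "pmf (quenched_law e n) 1 = lf_slope e n / (lf_comp e n 1)\<^sup>2"
proof (rule pmf_1_eq_pgf_derivative)
  define u W where "u = lf_slope e n" and "W = lf_comp e n 1"
  have W: "1 \<le> W"
    unfolding W_def by (rule lf_comp_ge_1) (use assms in auto)
  show "pgf (quenched_law e n) s = 1 - 1 / (u * (1 / (1 - s) - 1) + W)" if "0 \<le> s" "s < 1" for s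
    using pgf_quenched_law[OF assms that] lf_comp_affine[of e n "1 / (1 - s)"]
    by (simp add: u_def W_def)
  show "((\<lambda>s. 1 - 1 / (u * (1 / (1 - s) - 1) + W)) has_field_derivative
      lf_slope e n / (lf_comp e n 1)\<^sup>2) (at 0)"
    using W by (auto intro!: derivative_eq_intros simp: u_def W_def power2_eq_square)
qed

section \<open>Measurability in the environment\<close>

lemma space_Delta [simp]: "space Delta = UNIV"
  by (simp add: Delta_def)

lemma measurable_pmf_Delta [measurable]: "(\<lambda>q. pmf q k) \<in> borel_measurable Delta"
proof -
  have "(\<lambda>\<mu>. measure \<mu> {k}) \<in> borel_measurable (prob_algebra (count_space (UNIV :: nat set)))"
    unfolding prob_algebra_def by (intro measurable_restrict_space1) measurable
  moreover have "measure_pmf \<in> Delta \<rightarrow>\<^sub>M prob_algebra (count_space (UNIV :: nat set))"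
    unfolding Delta_def
    by (rule measurable_vimage_algebra1)
      (auto simp: space_prob_algebra intro: prob_space_measure_pmf)
  ultimately show ?thesis
    unfolding pmf.rep_eq by (rule measurable_compose[rotated])
qed

lemma measurable_log_mean [measurable]: "log_mean \<in> borel_measurable Delta"
  unfolding log_mean_def[abs_def] offspring_mean_def by measurable

lemma measurable_lf_map [measurable]:
  assumes [measurable]: "f \<in> M \<rightarrow>\<^sub>M Delta" "v \<in> borel_measurable M"
  shows "(\<lambda>x. lf_map (f x) (v x)) \<in> borel_measurable M"
  unfolding lf_map_def by measurable

text \<open>The parameter \<open>p\<close> can be recovered from the weights at \<open>0\<close> and \<open>1\<close>. This removes the quantifiers over
  real parameters, and the remaining condition is a countable conjunction of measurable ones.\<close>

lemma linear_fractional_iff: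
  "linear_fractional q \<longleftrightarrow>
    (let a = pmf q 0; p = 1 - pmf q 1 / (1 - a) in
      a < 1 \<and> 0 < p \<and> p < 1 \<and> (\<forall>k. pmf q (Suc k) = (1 - a) * (1 - p) / p * p ^ Suc k))"
    (is "_ \<longleftrightarrow> ?R")
proof
  assume "linear_fractional q"
  then obtain a p where *: "0 \<le> a" "a < 1" "0 < p" "p < 1" "pmf q 0 = a"
    "\<And>k. k \<ge> 1 \<Longrightarrow> pmf q k = (1 - a) * (1 - p) / p * p ^ k"
    by (auto elim: linear_fractionalE)
  have "pmf q 1 = (1 - a) * (1 - p)"
    using *(3) *(6)[of 1] by simp
  then have p: "p = 1 - pmf q 1 / (1 - a)"
    using * by simp
  have "pmf q (Suc k) = (1 - a) * (1 - p) / p * p ^ Suc k" for k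
    by (rule *(6)) simp
  then show ?R
    unfolding Let_def *(5) p[symmetric] using *(2-4) by blast
next
  define a p where "a = pmf q 0" and "p = 1 - pmf q 1 / (1 - a)"
  assume ?R
  then have ap: "a < 1" "0 < p" "p < 1"
    and Suc: "\<And>k. pmf q (Suc k) = (1 - a) * (1 - p) / p * p ^ Suc k"
    unfolding Let_def a_def[symmetric] p_def[symmetric] by blast+
  have "pmf q k = (1 - a) * (1 - p) / p * p ^ k" if "k \<ge> 1" for k
    using Suc[of "k - 1"] that by simp
  moreover have "0 \<le> a"
    by (simp add: a_def)
  ultimately show "linear_fractional q"
    unfolding linear_fractional_def using ap a_def by blast
qed

lemma pred_linear_fractional [measurable]: "Measurable.pred Delta linear_fractional"
proof -
  define p where "p q = 1 - pmf q 1 / (1 - pmf q 0)" for q :: "nat pmf"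
  have p [measurable]: "p \<in> borel_measurable Delta"
    unfolding p_def by measurable
  have "linear_fractional = (\<lambda>q. pmf q 0 < 1 \<and> 0 < p q \<and> p q < 1 \<and>
      (\<forall>k. pmf q (Suc k) = (1 - pmf q 0) * (1 - p q) / p q * p q ^ Suc k))"
    by (simp add: fun_eq_iff linear_fractional_iff Let_def p_def)
  also have "Measurable.pred Delta \<dots>"
    by measurable
  finally show ?thesis .
qed

lemma sets_linear_fractional [measurable]: "{q. linear_fractional q} \<in> sets Delta"
  using pred_linear_fractional by (simp add: pred_def)

lemma ennreal_pmf_bind_nat:
  fixes r :: "nat pmf"
  shows "ennreal (pmf (bind_pmf r f) k) = (\<Sum>x. ennreal (pmf r x) * ennreal (pmf (f x) k))"
  by (simp add: ennreal_pmf_bind nn_integral_measure_pmf nn_integral_count_space_nat)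

text \<open>Convolutions and mixtures of laws are infinite series of products of weights. As \<^typ>\<open>ennreal\<close>-valued
  functions they are measurable without a discussion of convergence.\<close>

lemma borel_measurable_from_ennreal:
  assumes "(\<lambda>x. ennreal (f x)) \<in> borel_measurable M" "\<And>x. 0 \<le> f x"
  shows "f \<in> borel_measurable M"
proof -
  have "(\<lambda>x. enn2real (ennreal (f x))) \<in> borel_measurable M"
    using assms(1) by measurable
  then show ?thesis
    using assms(2) by simp
qed

lemma pmf_map_add:
  "pmf (map_pmf (\<lambda>y. x + y) r) k = (if x \<le> k then pmf r (k - x) else 0)" for x k :: nat
proof (cases "x \<le> k")
  case True
  then have "pmf (map_pmf (\<lambda>y. x + y) r) (x + (k - x)) = pmf r (k - x)"
    by (intro pmf_map_inj') (simp add: inj_on_def)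
  with True show ?thesis by simp
next
  case False
  then show ?thesis
    by (auto simp: pmf_eq_0_set_pmf)
qed

lemma measurable_pmf_conv_power [measurable]:
  "(\<lambda>q. pmf (conv_power q z) k) \<in> borel_measurable Delta"
proof (induction z arbitrary: k)
  case 0
  show ?case by (simp add: conv_power_0)
next
  case (Suc z)
  note [measurable] = Suc
  show ?case
    by (rule borel_measurable_from_ennreal)
      (simp_all add: conv_power_Suc ennreal_pmf_bind_nat pmf_map_add pmf_nonneg)
qed

lemma measurable_pmf_quenched_law [measurable]:
  "(\<lambda>e. pmf (quenched_law e n) k) \<in> borel_measurable env_space"
proof (induction n arbitrary: k)
  case 0
  show ?case by simp
next
  case (Suc n)
  note [measurable] = Suc
  have [measurable]: "(\<lambda>e. e (Suc n)) \<in> env_space \<rightarrow>\<^sub>M Delta"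
    by (rule measurable_component_singleton) simp
  have *: "(\<lambda>e. \<Sum>x. ennreal (pmf (quenched_law e n) x) * ennreal (pmf (conv_power (e (Suc n)) x) k))
      \<in> borel_measurable env_space"
    by measurable
  show ?case
    by (rule borel_measurable_from_ennreal) (auto simp only: quenched_law.simps ennreal_pmf_bind_nat pmf_nonneg intro!: *)
qed

text \<open>The starting point may depend on the environment so that induction can absorb the innermost map into it.\<close>

lemma measurable_lf_comp:
  assumes "{1..n} \<subseteq> J" "v \<in> borel_measurable (\<Pi>\<^sub>M i\<in>J. Delta)"
  shows "(\<lambda>e. lf_comp e n (v e)) \<in> borel_measurable (\<Pi>\<^sub>M i\<in>J. Delta)"
  using assms
proof (induction n arbitrary: v)
  case (Suc n)
  have [measurable]: "(\<lambda>e. e (Suc n)) \<in> (\<Pi>\<^sub>M i\<in>J. Delta) \<rightarrow>\<^sub>M Delta"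
    by (rule measurable_component_singleton) (use Suc in auto)
  note [measurable] = Suc.prems(2)
  show ?case
    unfolding lf_comp.simps by (rule Suc.IH) (use Suc.prems(1) in auto)
qed simp

lemma measurable_lf_slope:
  assumes "{1..n} \<subseteq> J"
  shows "(\<lambda>e. lf_slope e n) \<in> borel_measurable (\<Pi>\<^sub>M i\<in>J. Delta)"
proof -
  have [measurable]: "(\<lambda>e. e i) \<in> (\<Pi>\<^sub>M i\<in>J. Delta) \<rightarrow>\<^sub>M Delta" if "i \<in> {1..n}" for i
    by (rule measurable_component_singleton) (use assms that in auto)
  show ?thesis
    unfolding lf_slope_def by measurable
qed

section \<open>Averaging over the random environment\<close>

context branching_process_random_env
begin

lemma measurable_environment [measurable]: "environment E \<in> M \<rightarrow>\<^sub>M env_space"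
  unfolding environment_def[abs_def]
  using env_indep by (intro measurable_restrict) (auto simp: indep_vars_def)

lemma environment_at: "i \<ge> 1 \<Longrightarrow> environment E \<omega> i = E i \<omega>"
  by (simp add: environment_def)

lemma history_map_measurable:
  "(\<lambda>\<omega>. (environment E \<omega>, \<lambda>i\<in>{..n}. Z i \<omega>))
     \<in> M \<rightarrow>\<^sub>M env_space \<Otimes>\<^sub>M (\<Pi>\<^sub>M i\<in>{..n}. count_space UNIV)"
  using Z_measurable by (intro measurable_Pair measurable_environment measurable_restrict)

lemma subalgebra_history: "subalgebra M (history M E Z n)"
proof -
  let ?H = "\<lambda>\<omega>. (environment E \<omega>, \<lambda>i\<in>{..n}. Z i \<omega>)"
  let ?N = "env_space \<Otimes>\<^sub>M (\<Pi>\<^sub>M i\<in>{..n}. count_space UNIV)"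
  have "?H \<in> space M \<rightarrow> space ?N"
    using history_map_measurable[of n] by (rule measurable_space[THEN Pi_I])
  then show ?thesis
    using measurable_sets[OF history_map_measurable[of n]]
    by (auto simp: subalgebra_def history_def sets_vimage_algebra2)
qed

lemma measurable_history:
  assumes "h \<in> env_space \<rightarrow>\<^sub>M N"
  shows "(\<lambda>\<omega>. h (environment E \<omega>)) \<in> history M E Z n \<rightarrow>\<^sub>M N"
proof -
  have "(\<lambda>\<omega>. (environment E \<omega>, \<lambda>i\<in>{..n}. Z i \<omega>))
     \<in> history M E Z n \<rightarrow>\<^sub>M env_space \<Otimes>\<^sub>M (\<Pi>\<^sub>M i\<in>{..n}. count_space UNIV)"
    unfolding history_def
    by (rule measurable_vimage_algebra1) (use history_map_measurable[of n] in \<open>auto dest: measurable_space\<close>)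
  from measurable_compose[OF measurable_compose[OF this measurable_fst] assms] show ?thesis
    by simp
qed

text \<open>Conditioning step by step: the transition rule turns the event \<open>Z\<^sub>n\<^sub>+\<^sub>1 = k\<close> into a factor that depends on
  the environment and on \<open>Z\<^sub>n\<close>. After splitting according to the value \<open>z\<close> of \<open>Z\<^sub>n\<close>, this factor is a
  function of the environment alone. The weight \<open>h\<close> is there to absorb it before the induction hypothesis
  is applied to each \<open>z\<close>.\<close>

lemma nn_integral_quenched:
  assumes start: "AE \<omega> in M. Z 0 \<omega> = 1"
    and h: "h \<in> borel_measurable env_space" "\<And>e. 0 \<le> h e" "\<And>e. h e \<le> 1"
  shows "(\<integral>\<^sup>+\<omega>. ennreal (h (environment E \<omega>)) * indicator {\<omega>. Z n \<omega> = k} \<omega> \<partial>M)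
       = (\<integral>\<^sup>+\<omega>. ennreal (h (environment E \<omega>)) * ennreal (pmf (quenched_law (environment E \<omega>) n) k) \<partial>M)"
  using h
proof (induction n arbitrary: h k)
  case 0
  from start show ?case
    by (intro nn_integral_cong_AE) (auto simp: indicator_def)
next
  case (Suc n)
  note [measurable] = Z_measurable Suc.prems(1)
  have [measurable]: "(\<lambda>e. e (Suc n)) \<in> env_space \<rightarrow>\<^sub>M Delta"
    by (rule measurable_component_singleton) simp
  define A where "A = {\<omega> \<in> space M. Z (Suc n) \<omega> = k}"
  have [measurable]: "A \<in> sets M" unfolding A_def by measurable
  define c where "c z e = pmf (conv_power (e (Suc n)) z) k" for z and e :: "nat \<Rightarrow> nat pmf"
  have c_meas [measurable]: "c z \<in> borel_measurable env_space" for z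
    unfolding c_def by measurable
  have c: "0 \<le> c z e" "c z e \<le> 1" for z e
    by (auto simp: c_def pmf_le_1)
  let ?e = "environment E"
  interpret finite_measure_subalgebra M "history M E Z n"
    using subalgebra_history by unfold_locales
  have int: "integrable M (\<lambda>\<omega>. h (?e \<omega>) * indicator A \<omega>)"
    by (rule integrable_const_bound[where B = 1])
      (use Suc.prems in \<open>auto simp: indicator_def\<close>)
  note cond = real_cond_exp_intg[OF int measurable_history[OF Suc.prems(1)], simplified]
  have AE_eq: "AE \<omega> in M. h (?e \<omega>) * real_cond_exp M (history M E Z n) (indicator A) \<omega>
      = h (?e \<omega>) * c (Z n \<omega>) (?e \<omega>)"
    using transition[of n k] by eventually_elim (simp add: c_def A_def environment_at)
  have "(\<integral>\<^sup>+\<omega>. ennreal (h (?e \<omega>)) * indicator {\<omega>. Z (Suc n) \<omega> = k} \<omega> \<partial>M)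
      = (\<integral>\<^sup>+\<omega>. ennreal (h (?e \<omega>) * indicator A \<omega>) \<partial>M)"
    by (intro nn_integral_cong) (auto simp: A_def indicator_def)
  also have "\<dots> = ennreal (\<integral>\<omega>. h (?e \<omega>) * indicator A \<omega> \<partial>M)"
    using int Suc.prems by (intro nn_integral_eq_integral) auto
  also have "\<dots> = ennreal (\<integral>\<omega>. h (?e \<omega>) * real_cond_exp M (history M E Z n) (indicator A) \<omega> \<partial>M)"
    using cond by simp
  also have "\<dots> = (\<integral>\<^sup>+\<omega>. ennreal (h (?e \<omega>) * real_cond_exp M (history M E Z n) (indicator A) \<omega>) \<partial>M)"
    using AE_eq c Suc.prems
    by (intro nn_integral_eq_integral[symmetric] cond) auto
  also have "\<dots> = (\<integral>\<^sup>+\<omega>. ennreal (h (?e \<omega>) * c (Z n \<omega>) (?e \<omega>)) \<partial>M)"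
    using AE_eq by (intro nn_integral_cong_AE) auto
  also have "\<dots> = (\<integral>\<^sup>+\<omega>. (\<Sum>z. ennreal (h (?e \<omega>) * c z (?e \<omega>)) * indicator {\<omega>. Z n \<omega> = z} \<omega>) \<partial>M)"
  proof (intro nn_integral_cong)
    fix \<omega>
    show "ennreal (h (?e \<omega>) * c (Z n \<omega>) (?e \<omega>))
        = (\<Sum>z. ennreal (h (?e \<omega>) * c z (?e \<omega>)) * indicator {\<omega>. Z n \<omega> = z} \<omega>)"
      by (subst suminf_finite[of "{Z n \<omega>}"]) auto
  qed
  also have "\<dots> = (\<Sum>z. \<integral>\<^sup>+\<omega>. ennreal (h (?e \<omega>) * c z (?e \<omega>)) * indicator {\<omega>. Z n \<omega> = z} \<omega> \<partial>M)"
  proof (rule nn_integral_suminf)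
    fix z
    have "(\<lambda>\<omega>. indicator {\<omega>. Z n \<omega> = z} \<omega> :: ennreal) = (\<lambda>\<omega>. indicator {z} (Z n \<omega>))"
      by (auto simp: indicator_def)
    also have "\<dots> \<in> borel_measurable M"
      by (rule measurable_compose[OF Z_measurable]) simp
    finally have [measurable]: "(\<lambda>\<omega>. indicator {\<omega>. Z n \<omega> = z} \<omega> :: ennreal) \<in> borel_measurable M" .
    show "(\<lambda>\<omega>. ennreal (h (?e \<omega>) * c z (?e \<omega>)) * indicator {\<omega>. Z n \<omega> = z} \<omega>) \<in> borel_measurable M"
      by measurable
  qed
  also have "\<dots> = (\<Sum>z. \<integral>\<^sup>+\<omega>. ennreal (h (?e \<omega>) * c z (?e \<omega>)) * ennreal (pmf (quenched_law (?e \<omega>) n) z) \<partial>M)"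
  proof (intro suminf_cong Suc.IH)
    show "(\<lambda>e. h e * c z e) \<in> borel_measurable env_space" for z
      by measurable
  qed (use Suc.prems c in \<open>auto simp: mult_le_one\<close>)
  also have "\<dots> = (\<integral>\<^sup>+\<omega>. (\<Sum>z. ennreal (h (?e \<omega>) * c z (?e \<omega>)) * ennreal (pmf (quenched_law (?e \<omega>) n) z)) \<partial>M)"
    by (rule nn_integral_suminf[symmetric]) measurable
  also have "\<dots> = (\<integral>\<^sup>+\<omega>. ennreal (h (?e \<omega>)) * ennreal (pmf (quenched_law (?e \<omega>) (Suc n)) k) \<partial>M)"
  proof (intro nn_integral_cong)
    fix \<omega>
    have "ennreal (h (?e \<omega>) * c z (?e \<omega>)) * ennreal (pmf (quenched_law (?e \<omega>) n) z)
        = ennreal (h (?e \<omega>)) * (ennreal (pmf (quenched_law (?e \<omega>) n) z) * ennreal (c z (?e \<omega>)))" for z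
      using Suc.prems c by (simp only: ennreal_mult' mult_ac)
    then show "(\<Sum>z. ennreal (h (?e \<omega>) * c z (?e \<omega>)) * ennreal (pmf (quenched_law (?e \<omega>) n) z))
        = ennreal (h (?e \<omega>)) * ennreal (pmf (quenched_law (?e \<omega>) (Suc n)) k)"
      by (simp only: quenched_law.simps ennreal_pmf_bind_nat ennreal_suminf_cmult c_def)
  qed
  finally show ?case .
qed

end

section \<open>The transfer operator of the random affine map\<close>

text \<open>The Markov transition operator \<open>f \<mapsto> (w \<mapsto> E[f(g\<^sub>q(w))])\<close> of the random affine map \<open>g\<^sub>q\<close> with
  \<open>q\<close> drawn from \<open>N\<close>.\<close>

definition lf_op :: "nat pmf measure \<Rightarrow> (real \<Rightarrow> ennreal) \<Rightarrow> real \<Rightarrow> ennreal" where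
  "lf_op N f w = (\<integral>\<^sup>+q. f (lf_map q w) \<partial>N)"

lemma lf_op_funpow_Suc:
  "(lf_op N ^^ Suc n) f w = (\<integral>\<^sup>+q. (lf_op N ^^ n) f (lf_map q w) \<partial>N)"
  by (simp add: lf_op_def[of N "(lf_op N ^^ n) f"])

locale lf_prob_space = prob_space N for N :: "nat pmf measure" +
  assumes sets_N [measurable_cong]: "sets N = sets Delta"
    and AE_lf: "AE q in N. linear_fractional q"
begin

lemma measurable_lf_op [measurable]:
  assumes [measurable]: "f \<in> borel_measurable borel"
  shows "lf_op N f \<in> borel_measurable borel"
  unfolding lf_op_def[abs_def] by measurable

lemma measurable_funpow_lf_op [measurable]:
  assumes "f \<in> borel_measurable borel"
  shows "(lf_op N ^^ n) f \<in> borel_measurable borel"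
  using assms by (induction n) (auto intro: measurable_lf_op)

lemma funpow_lf_op_mono:
  assumes "\<And>v. 1 \<le> v \<Longrightarrow> f v \<le> g v" "1 \<le> w"
  shows "(lf_op N ^^ n) f w \<le> (lf_op N ^^ n) g w"
  using assms(2)
proof (induction n arbitrary: w)
  case 0
  with assms(1) show ?case by simp
next
  case (Suc n)
  have "AE q in N. (lf_op N ^^ n) f (lf_map q w) \<le> (lf_op N ^^ n) g (lf_map q w)"
    using AE_lf by eventually_elim (use Suc lf_map_ge_1 in auto)
  then show ?case
    unfolding lf_op_funpow_Suc by (rule nn_integral_mono_AE)
qed

lemma funpow_lf_op_antimono:
  assumes "\<And>v w. 1 \<le> v \<Longrightarrow> v \<le> w \<Longrightarrow> f w \<le> f v" "1 \<le> v" "v \<le> w"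
  shows "(lf_op N ^^ n) f w \<le> (lf_op N ^^ n) f v"
  using assms(2,3)
proof (induction n arbitrary: v w)
  case 0
  with assms(1) show ?case by simp
next
  case (Suc n)
  have "AE q in N. (lf_op N ^^ n) f (lf_map q w) \<le> (lf_op N ^^ n) f (lf_map q v)"
    using AE_lf by eventually_elim (use Suc lf_map_ge_1 lf_map_mono in auto)
  then show ?case
    unfolding lf_op_funpow_Suc by (rule nn_integral_mono_AE)
qed

text \<open>The chain starts at the left end of its state space \<open>[1, \<infinity>)\<close>. Its first step moves it upwards, and by
  monotonicity of the maps the later steps preserve this order.\<close>

lemma decseq_funpow_lf_op:
  assumes "\<And>v w. 1 \<le> v \<Longrightarrow> v \<le> w \<Longrightarrow> f w \<le> f v"
  shows "decseq (\<lambda>n. (lf_op N ^^ n) f 1)"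
proof (rule decseq_SucI)
  fix n
  have "AE q in N. (lf_op N ^^ n) f (lf_map q 1) \<le> (lf_op N ^^ n) f 1"
    using AE_lf by eventually_elim (rule funpow_lf_op_antimono; use assms lf_map_ge_1 in auto)
  then have "(\<integral>\<^sup>+q. (lf_op N ^^ n) f (lf_map q 1) \<partial>N) \<le> (\<integral>\<^sup>+q. (lf_op N ^^ n) f 1 \<partial>N)"
    by (rule nn_integral_mono_AE)
  then show "(lf_op N ^^ Suc n) f 1 \<le> (lf_op N ^^ n) f 1"
    by (simp add: lf_op_funpow_Suc emeasure_space_1 del: funpow.simps)
qed

lemma funpow_lf_op_add_cmult:
  assumes [measurable]: "f \<in> borel_measurable borel" "g \<in> borel_measurable borel"
  shows "(lf_op N ^^ n) (\<lambda>v. f v + c * g v) w = (lf_op N ^^ n) f w + c * (lf_op N ^^ n) g w"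
proof (induction n arbitrary: w)
  case (Suc n)
  have "(lf_op N ^^ Suc n) (\<lambda>v. f v + c * g v) w
      = (\<integral>\<^sup>+q. (lf_op N ^^ n) f (lf_map q w) + c * (lf_op N ^^ n) g (lf_map q w) \<partial>N)"
    unfolding lf_op_funpow_Suc Suc ..
  also have "\<dots> = (\<integral>\<^sup>+q. (lf_op N ^^ n) f (lf_map q w) \<partial>N) + c * (\<integral>\<^sup>+q. (lf_op N ^^ n) g (lf_map q w) \<partial>N)"
    by (simp add: nn_integral_add nn_integral_cmult)
  finally show ?case
    unfolding lf_op_funpow_Suc .
qed simp

lemma funpow_lf_op_1: "(lf_op N ^^ n) (\<lambda>_. 1) w = 1"
  by (induction n arbitrary: w) (simp_all add: lf_op_def emeasure_space_1)

lemma integrable_ln_lf_map_ratio: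
  assumes "integrable N log_mean" "integrable N (\<lambda>q. ln (1 - pmf q 0))" "1 \<le> w"
  shows "integrable N (\<lambda>q. ln (lf_map q w / w))"
    and "AE q in N. \<bar>ln (lf_map q w / w)\<bar> \<le> \<bar>log_mean q\<bar> + \<bar>ln (1 - pmf q 0)\<bar>"
proof -
  show bound: "AE q in N. \<bar>ln (lf_map q w / w)\<bar> \<le> \<bar>log_mean q\<bar> + \<bar>ln (1 - pmf q 0)\<bar>"
    using AE_lf
  proof eventually_elim
    case (elim q)
    have pos: "0 < 1 - pmf q 0"
      using elim by (auto elim!: linear_fractionalE)
    have "ln (exp (- log_mean q)) \<le> ln (lf_map q w / w)"
      using lf_map_divide(1)[OF elim assms(3)] by (intro ln_mono) simp_all
    moreover have "ln (lf_map q w / w) \<le> ln (1 / (1 - pmf q 0))"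
      using less_le_trans[OF exp_gt_zero lf_map_divide(1)[OF elim assms(3)]]
        lf_map_divide(2)[OF elim assms(3)] by (intro ln_mono)
    moreover have "ln (1 / (1 - pmf q 0)) = - ln (1 - pmf q 0)"
      using pos by (simp add: ln_div)
    ultimately show ?case
      unfolding ln_exp by linarith
  qed
  show "integrable N (\<lambda>q. ln (lf_map q w / w))"
    by (rule Bochner_Integration.integrable_bound[of _ "\<lambda>q. \<bar>log_mean q\<bar> + \<bar>ln (1 - pmf q 0)\<bar>"])
      (use assms bound in auto)
qed

text \<open>For large \<open>w\<close> the affine map is nearly the multiplication by its slope, so the mean increment of the
  logarithm tends to the mean of \<open>- log_mean\<close>.\<close>

lemma drift_limit:
  assumes "integrable N log_mean" "integrable N (\<lambda>q. ln (1 - pmf q 0))"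
  shows "(\<lambda>k. \<integral>q. ln (lf_map q (real (Suc k)) / real (Suc k)) \<partial>N) \<longlonglongrightarrow> (\<integral>q. - log_mean q \<partial>N)"
proof (rule integral_dominated_convergence[where w = "\<lambda>q. \<bar>log_mean q\<bar> + \<bar>ln (1 - pmf q 0)\<bar>"])
  show "AE q in N. (\<lambda>k. ln (lf_map q (real (Suc k)) / real (Suc k))) \<longlonglongrightarrow> - log_mean q"
    using AE_lf
  proof eventually_elim
    case (elim q)
    define \<kappa> where "\<kappa> = 1 / (1 - pmf q 0) - exp (- log_mean q)"
    have "lf_map q (real (Suc k)) / real (Suc k) = exp (- log_mean q) + \<kappa> * inverse (real (Suc k))" for k
      by (simp add: lf_map_def \<kappa>_def field_simps)
    moreover have "(\<lambda>k. exp (- log_mean q) + \<kappa> * inverse (real (Suc k))) \<longlonglongrightarrow> exp (- log_mean q) + \<kappa> * 0"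
      by (intro tendsto_intros LIMSEQ_inverse_real_of_nat)
    ultimately have "(\<lambda>k. ln (lf_map q (real (Suc k)) / real (Suc k))) \<longlonglongrightarrow> ln (exp (- log_mean q))"
      by (intro tendsto_ln) simp_all
    then show ?case by simp
  qed
  show "AE q in N. norm (ln (lf_map q (real (Suc k)) / real (Suc k))) \<le> \<bar>log_mean q\<bar> + \<bar>ln (1 - pmf q 0)\<bar>" for k
    using integrable_ln_lf_map_ratio(2)[OF assms, of "real (Suc k)"] by simp
qed (use assms in auto)

text \<open>A Lyapunov estimate for the function \<open>ln\<close>. Beyond some \<open>K\<close> the mean increment of \<open>ln\<close> is below half of
  its limit. On \<open>[1, K]\<close> it is bounded by its value at \<open>1\<close>, and there the term \<open>C / w\<^sup>2\<close> compensates for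
  it once \<open>C\<close> carries the factor \<open>K\<^sup>2\<close>. In \<^typ>\<open>ennreal\<close> the negative drift has to stand on the left.\<close>

lemma drift_inequality:
  assumes int: "integrable N log_mean" "integrable N (\<lambda>q. ln (1 - pmf q 0))"
    and pos: "0 < (\<integral>q. log_mean q \<partial>N)"
  obtains \<delta> C where "0 < \<delta>" "0 \<le> C"
    "\<And>w. 1 \<le> w \<Longrightarrow> lf_op N (\<lambda>v. ennreal (ln v)) w + ennreal \<delta>
        \<le> ennreal (ln w) + ennreal C * ennreal (1 / w\<^sup>2)"
proof -
  define h where "h w = (\<integral>q. ln (lf_map q w / w) \<partial>N)" for w
  define \<delta> where "\<delta> = (\<integral>q. log_mean q \<partial>N) / 2"
  have \<delta>: "0 < \<delta>"
    using pos by (simp add: \<delta>_def)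
  have h_mono: "h v \<le> h w" if "1 \<le> w" "w \<le> v" for v w
    unfolding h_def
  proof (rule integral_mono_AE)
    show "AE q in N. ln (lf_map q v / v) \<le> ln (lf_map q w / w)"
      using AE_lf
    proof eventually_elim
      case (elim q)
      have "0 < lf_map q v / v"
        using that by (intro less_le_trans[OF exp_gt_zero lf_map_divide(1)[OF elim]]) simp
      with lf_map_divide(3)[OF elim that] show ?case
        by (intro ln_mono)
    qed
  qed (use integrable_ln_lf_map_ratio int that in auto)
  have "(\<lambda>k. h (real (Suc k))) \<longlonglongrightarrow> - (2 * \<delta>)"
    using drift_limit[OF int] unfolding h_def \<delta>_def by simp
  then have "eventually (\<lambda>k. h (real (Suc k)) < - \<delta>) sequentially"
    using \<delta> by (intro order_tendstoD(2)) auto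
  then obtain k where k: "h (real (Suc k)) < - \<delta>"
    by (auto simp: eventually_sequentially)
  define K where "K = real (Suc k)"
  have K: "1 \<le> K" "h K \<le> - \<delta>"
    using k by (auto simp: K_def)
  define C where "C = (\<bar>h 1\<bar> + \<delta>) * K\<^sup>2"
  have C: "0 \<le> C"
    using \<delta> by (simp add: C_def)
  have h_le: "h w + \<delta> \<le> C * (1 / w\<^sup>2)" if w: "1 \<le> w" for w
  proof (cases "K \<le> w")
    case True
    then have "h w + \<delta> \<le> 0"
      using h_mono[of K w] K by simp
    also have "0 \<le> C * (1 / w\<^sup>2)"
      using C by simp
    finally show ?thesis .
  next
    case False
    have "h w + \<delta> \<le> \<bar>h 1\<bar> + \<delta>"
      using h_mono[of 1 w] w by simp
    also have "\<dots> \<le> (\<bar>h 1\<bar> + \<delta>) * (K / w)\<^sup>2"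
      using mult_left_mono[of 1 "(K / w)\<^sup>2" "\<bar>h 1\<bar> + \<delta>"] False w \<delta> by (simp add: one_le_power)
    also have "\<dots> = C * (1 / w\<^sup>2)"
      by (simp add: C_def power_divide)
    finally show ?thesis .
  qed
  have "lf_op N (\<lambda>v. ennreal (ln v)) w + ennreal \<delta> \<le> ennreal (ln w) + ennreal C * ennreal (1 / w\<^sup>2)"
    if w: "1 \<le> w" for w
  proof -
    have AE1: "AE q in N. 1 \<le> lf_map q w"
      using AE_lf by eventually_elim (use lf_map_ge_1 w in auto)
    have eq: "AE q in N. ln (lf_map q w) = ln w + ln (lf_map q w / w)"
      using AE1 by eventually_elim (use w in \<open>simp add: ln_div\<close>)
    have int_w: "integrable N (\<lambda>q. ln (lf_map q w / w))"
      using integrable_ln_lf_map_ratio int w by auto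
    have nonneg: "AE q in N. 0 \<le> ln w + ln (lf_map q w / w)"
      using AE1 eq by eventually_elim (metis ln_ge_zero)
    have lint: "(\<integral>q. ln w + ln (lf_map q w / w) \<partial>N) = ln w + h w"
      using int_w by (simp add: h_def prob_space)
    have "0 \<le> (\<integral>q. ln w + ln (lf_map q w / w) \<partial>N)"
      using nonneg by (rule integral_nonneg_AE)
    then have nn: "0 \<le> ln w + h w"
      by (simp add: lint)
    have "lf_op N (\<lambda>v. ennreal (ln v)) w = (\<integral>\<^sup>+q. ennreal (ln w + ln (lf_map q w / w)) \<partial>N)"
      unfolding lf_op_def using eq by (intro nn_integral_cong_AE) auto
    also have "\<dots> = ennreal (ln w + h w)"
      using int_w nonneg lint by (subst nn_integral_eq_integral) auto
    finally have "lf_op N (\<lambda>v. ennreal (ln v)) w + ennreal \<delta> = ennreal (ln w + h w + \<delta>)"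
      using nn \<delta> by (simp add: ennreal_plus)
    also have "\<dots> \<le> ennreal (ln w + C * (1 / w\<^sup>2))"
      using h_le[OF w] by (intro ennreal_leI) simp
    also have "\<dots> = ennreal (ln w) + ennreal C * ennreal (1 / w\<^sup>2)"
      using w C by (simp add: ennreal_plus ennreal_mult'[symmetric] del: times_divide_eq_right)
    finally show ?thesis .
  qed
  with \<delta> C show ?thesis
    by (rule that)
qed

text \<open>The drift inequality summed along the chain started at \<open>1\<close>. Since no term is ever subtracted, the
  integrals may be infinite.\<close>

lemma linear_growth_le_sum:
  assumes meas: "f \<in> borel_measurable borel" "g \<in> borel_measurable borel"
    and drift: "\<And>w. 1 \<le> w \<Longrightarrow> lf_op N f w + d \<le> f w + c * g w"
  shows "(lf_op N ^^ n) f 1 + of_nat n * d \<le> f 1 + c * (\<Sum>k<n. (lf_op N ^^ k) g 1)"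
proof (induction n)
  case (Suc n)
  have "(lf_op N ^^ Suc n) f 1 + d = (lf_op N ^^ n) (lf_op N f) 1 + d * (lf_op N ^^ n) (\<lambda>_. 1) 1"
    by (simp add: funpow_swap1 funpow_lf_op_1)
  also have "\<dots> = (lf_op N ^^ n) (\<lambda>w. lf_op N f w + d * 1) 1"
    using meas by (intro funpow_lf_op_add_cmult[symmetric] measurable_lf_op) auto
  also have "\<dots> \<le> (lf_op N ^^ n) (\<lambda>w. f w + c * g w) 1"
    using drift by (intro funpow_lf_op_mono) auto
  also have "\<dots> = (lf_op N ^^ n) f 1 + c * (lf_op N ^^ n) g 1"
    using meas by (rule funpow_lf_op_add_cmult)
  finally have "(lf_op N ^^ Suc n) f 1 + d + of_nat n * d
      \<le> (lf_op N ^^ n) f 1 + c * (lf_op N ^^ n) g 1 + of_nat n * d"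
    by (rule add_right_mono)
  also have "\<dots> = (lf_op N ^^ n) f 1 + of_nat n * d + c * (lf_op N ^^ n) g 1"
    by (simp add: ac_simps)
  also have "\<dots> \<le> f 1 + c * (\<Sum>k<n. (lf_op N ^^ k) g 1) + c * (lf_op N ^^ n) g 1"
    using Suc by (rule add_right_mono)
  finally show ?case
    by (simp add: distrib_left distrib_right ac_simps del: funpow.simps)
qed simp

text \<open>If the decreasing sequence of expectations of \<open>w\<^sup>-\<^sup>2\<close> tended to \<open>0\<close>, so would its averages, whereas by
  \<open>linear_growth_le_sum\<close> for \<open>ln\<close> the averages multiplied by \<open>C\<close> are at least \<open>\<delta>\<close>.\<close>

lemma funpow_lf_op_tendsto_pos:
  assumes int: "integrable N log_mean" "integrable N (\<lambda>q. ln (1 - pmf q 0))"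
    and pos: "0 < (\<integral>q. log_mean q \<partial>N)"
  obtains b \<theta> where "\<And>n. (lf_op N ^^ n) (\<lambda>w. ennreal (1 / w\<^sup>2)) 1 = ennreal (b n)"
    "\<And>n. 0 \<le> b n" "0 < \<theta>" "b \<longlonglongrightarrow> \<theta>"
proof -
  define g :: "real \<Rightarrow> ennreal" where "g w = ennreal (1 / w\<^sup>2)" for w
  have g_meas: "g \<in> borel_measurable borel"
    unfolding g_def by measurable
  have g_anti: "g w \<le> g v" if "1 \<le> v" "v \<le> w" for v w
    unfolding g_def using that by (intro ennreal_leI divide_left_mono power_mono) auto
  define a where "a n = (lf_op N ^^ n) g 1" for n
  define b where "b n = enn2real (a n)" for n
  have dec: "decseq a"
    unfolding a_def using g_anti by (rule decseq_funpow_lf_op)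
  then have le1: "a n \<le> 1" for n
    using decseqD[OF dec, of 0 n] by (simp add: a_def g_def)
  then have a_b: "a n = ennreal (b n)" for n
    unfolding b_def by (metis ennreal_enn2real ennreal_one_less_top le_less_trans)
  have b01: "0 \<le> b n" "b n \<le> 1" for n
    using le1[of n] unfolding a_b by (simp_all add: b_def)
  have "decseq b"
    using dec b01 by (auto simp: decseq_def a_b)
  then obtain \<theta> where \<theta>: "b \<longlonglongrightarrow> \<theta>" "\<And>n. \<theta> \<le> b n"
    using b01 decseq_convergent[of b 0] by auto
  obtain \<delta> C where \<delta>: "0 < \<delta>" and C: "0 \<le> C" and
    drift: "\<And>w. 1 \<le> w \<Longrightarrow> lf_op N (\<lambda>v. ennreal (ln v)) w + ennreal \<delta> \<le> ennreal (ln w) + ennreal C * g w"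
    using drift_inequality[OF assms] unfolding g_def by metis
  have sum: "real n * \<delta> \<le> C * (\<Sum>k<n. b k)" for n
  proof -
    have "of_nat n * ennreal \<delta>
        \<le> (lf_op N ^^ n) (\<lambda>v. ennreal (ln v)) 1 + of_nat n * ennreal \<delta>"
      by simp
    also have "\<dots> \<le> ennreal (ln 1) + ennreal C * (\<Sum>k<n. (lf_op N ^^ k) g 1)"
      using linear_growth_le_sum[OF _ g_meas drift, of n] by simp
    also have "\<dots> = ennreal (C * (\<Sum>k<n. b k))"
      using b01 C by (simp add: a_def[symmetric] a_b ennreal_mult' sum_nonneg)
    finally show ?thesis
      using b01 C \<delta> by (simp add: ennreal_of_nat_eq_real_of_nat ennreal_mult'[symmetric] sum_nonneg)
  qed
  have "0 \<le> \<theta>"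
    using \<theta>(1) b01 by (intro LIMSEQ_le_const[of b]) auto
  moreover have "\<theta> \<noteq> 0"
  proof
    assume "\<theta> = 0"
    \<comment> \<open>chosen such that \<open>C * \<epsilon>\<close> stays below \<open>\<delta> / 2\<close>, also when \<open>C = 0\<close>\<close>
    define \<epsilon> where "\<epsilon> = \<delta> / (2 * (C + 1))"
    have \<epsilon>: "0 < \<epsilon>" "C * \<epsilon> \<le> \<delta> / 2"
      using \<delta> C by (auto simp: \<epsilon>_def field_simps)
    obtain n0 where n0: "\<And>n. n \<ge> n0 \<Longrightarrow> b n < \<epsilon>"
      using order_tendstoD(2)[OF \<theta>(1), of \<epsilon>] \<open>\<theta> = 0\<close> \<epsilon> by (auto simp: eventually_sequentially)
    \<comment> \<open>for \<open>k < n0\<close> the trivial bound \<open>1\<close> costs at most \<open>n0\<close> in total\<close>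
    have bound: "b k \<le> (if k < n0 then 1 else 0) + \<epsilon>" for k
      using b01[of k] n0[of k] \<epsilon> by (cases "k < n0") auto
    have "real n * (\<delta> / 2) \<le> C * n0" for n
    proof -
      have "(\<Sum>k<n. b k) \<le> (\<Sum>k<n. (if k < n0 then 1 else 0) + \<epsilon>)"
        by (intro sum_mono bound)
      also have "\<dots> = real (card ({..<n} \<inter> {..<n0})) + real n * \<epsilon>"
        by (simp add: sum.distrib sum.If_cases lessThan_def)
      also have "\<dots> \<le> real n0 + real n * \<epsilon>"
        using card_mono[of "{..<n0}" "{..<n} \<inter> {..<n0}"] by simp
      finally have "C * (\<Sum>k<n. b k) \<le> C * (real n0 + real n * \<epsilon>)"
        using C by (rule mult_left_mono)
      moreover have "real n * (C * \<epsilon>) \<le> real n * (\<delta> / 2)"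
        using \<epsilon>(2) by (rule mult_left_mono) simp
      ultimately show ?thesis
        using sum[of n] by (simp add: algebra_simps)
    qed
    moreover obtain n where "C * n0 / (\<delta> / 2) < real n"
      using reals_Archimedean2 by blast
    ultimately show False
      using \<delta> by (auto simp: field_simps not_le[symmetric])
  qed
  ultimately have "0 < \<theta>" by simp
  moreover have "(lf_op N ^^ n) (\<lambda>w. ennreal (1 / w\<^sup>2)) 1 = ennreal (b n)" for n
    using a_b[of n] unfolding a_def g_def[abs_def] .
  ultimately show ?thesis
    using b01(1) \<theta>(1) by (intro that[of b \<theta>])
qed

end

section \<open>Change of measure over independent environments\<close>

text \<open>The innermost map of the composition belongs to the last law \<open>q\<close> of the environment. Integrating over the
  other laws first leaves \<open>exp (- log_mean q)\<close> times a function of \<open>lf_map q w\<close>; each such integral over \<open>q\<close>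
  produces one factor \<open>\<gamma>\<close> and one application of the transfer operator under the tilted law.\<close>

lemma nn_integral_PiM_lf_comp:
  assumes "prob_space D" and sets_D: "sets D = sets Delta" and N: "lf_prob_space N"
    and tilt: "\<And>F. F \<in> borel_measurable Delta \<Longrightarrow>
      (\<integral>\<^sup>+q. ennreal (exp (- log_mean q)) * F q \<partial>D) = ennreal \<gamma> * (\<integral>\<^sup>+q. F q \<partial>N)"
    and f: "f \<in> borel_measurable borel"
  shows "(\<integral>\<^sup>+e. ennreal (lf_slope e n) * f (lf_comp e n w) \<partial>(\<Pi>\<^sub>M i\<in>{1..n}. D))
      = ennreal \<gamma> ^ n * (lf_op N ^^ n) f w"
proof (induction n arbitrary: w)
  interpret D: prob_space D by fact
  interpret product_sigma_finite "\<lambda>_::nat. D" by unfold_locales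
  case 0
  show ?case
    by (simp add: lf_slope_def space_PiM_empty emeasure_PiM_empty)
next
  interpret D: prob_space D by fact
  interpret product_sigma_finite "\<lambda>_::nat. D" by unfold_locales
  interpret lf_prob_space N by fact
  case (Suc n)
  note [measurable_cong] = sets_D and [measurable] = f
  have PiM_sets: "sets (\<Pi>\<^sub>M i\<in>J. D) = sets (\<Pi>\<^sub>M i\<in>J. Delta)" for J :: "nat set"
    by (intro sets_PiM_cong) (simp_all add: sets_D)
  have meas: "(\<lambda>e. ennreal (lf_slope e n) * f (lf_comp e n w)) \<in> borel_measurable (\<Pi>\<^sub>M i\<in>{1..n}. D)" for n w
  proof -
    have [measurable]: "(\<lambda>e. lf_slope e n) \<in> borel_measurable (\<Pi>\<^sub>M i\<in>{1..n}. Delta)"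
      "(\<lambda>e. lf_comp e n w) \<in> borel_measurable (\<Pi>\<^sub>M i\<in>{1..n}. Delta)"
      by (auto intro: measurable_lf_slope measurable_lf_comp)
    show ?thesis
      unfolding measurable_cong_sets[OF PiM_sets refl] by measurable
  qed
  have split: "{1..Suc n} = insert (Suc n) {1..n}"
    by (simp add: atLeastAtMostSuc_conv)
  have upd: "lf_slope (e(Suc n := q)) (Suc n) = exp (- log_mean q) * lf_slope e n"
    "lf_comp (e(Suc n := q)) (Suc n) w = lf_comp e n (lf_map q w)" for e q
    using lf_slope_cong[of n "e(Suc n := q)" e] lf_comp_cong[of n "e(Suc n := q)" e]
    by (simp_all add: lf_slope_def)
  have "(\<integral>\<^sup>+e. ennreal (lf_slope e (Suc n)) * f (lf_comp e (Suc n) w) \<partial>(\<Pi>\<^sub>M i\<in>{1..Suc n}. D))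
      = (\<integral>\<^sup>+q. (\<integral>\<^sup>+e. ennreal (exp (- log_mean q)) * (ennreal (lf_slope e n) * f (lf_comp e n (lf_map q w)))
          \<partial>(\<Pi>\<^sub>M i\<in>{1..n}. D)) \<partial>D)"
    using meas[of "Suc n"] unfolding split
    by (subst product_nn_integral_insert_rev)
      (simp_all add: upd ennreal_mult' mult.assoc del: lf_comp.simps)
  also have "\<dots> = (\<integral>\<^sup>+q. ennreal (exp (- log_mean q)) * (ennreal \<gamma> ^ n * (lf_op N ^^ n) f (lf_map q w)) \<partial>D)"
    using meas[of n] by (simp only: nn_integral_cmult Suc)
  also have "\<dots> = ennreal \<gamma> * (\<integral>\<^sup>+q. ennreal \<gamma> ^ n * (lf_op N ^^ n) f (lf_map q w) \<partial>N)"
    by (rule tilt) measurable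
  also have "\<dots> = ennreal \<gamma> * (ennreal \<gamma> ^ n * (lf_op N ^^ Suc n) f w)"
    unfolding lf_op_funpow_Suc by (subst nn_integral_cmult) auto
  finally show ?case
    by (simp add: mult.assoc)
qed

context branching_process_random_env
begin

lemma distr_environment_segment:
  assumes "n \<ge> 1"
  shows "distr M (\<Pi>\<^sub>M i\<in>{1..n}. Delta) (\<lambda>\<omega>. \<lambda>i\<in>{1..n}. E i \<omega>) = (\<Pi>\<^sub>M i\<in>{1..n}. distr M Delta Q)"
proof -
  have "indep_vars (\<lambda>_. Delta) E {1..n}"
    by (rule indep_vars_subset[OF env_indep]) auto
  moreover have "E i \<in> M \<rightarrow>\<^sub>M Delta" if "i \<in> {1..n}" for i
    using env_indep that by (auto simp: indep_vars_def)
  ultimately have "distr M (\<Pi>\<^sub>M i\<in>{1..n}. Delta) (\<lambda>\<omega>. \<lambda>i\<in>{1..n}. E i \<omega>)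
      = (\<Pi>\<^sub>M i\<in>{1..n}. distr M Delta (E i))"
    using assms by (subst (asm) indep_vars_iff_distr_eq_PiM') auto
  also have "\<dots> = (\<Pi>\<^sub>M i\<in>{1..n}. distr M Delta Q)"
    by (rule PiM_cong) (auto simp: env_copies)
  finally show ?thesis .
qed

lemma AE_linear_fractional_environment:
  assumes "AE \<omega> in M. linear_fractional (Q \<omega>)" "i \<ge> 1"
  shows "AE \<omega> in M. linear_fractional (E i \<omega>)"
proof -
  note [measurable] = Q_measurable
  have [measurable]: "E i \<in> M \<rightarrow>\<^sub>M Delta"
    using env_indep assms(2) by (auto simp: indep_vars_def)
  have "AE q in distr M Delta Q. linear_fractional q"
    using assms(1) by (subst AE_distr_iff) auto
  then have "AE q in distr M Delta (E i). linear_fractional q"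
    unfolding env_copies[OF assms(2)] .
  then show ?thesis
    by (subst (asm) AE_distr_iff) auto
qed

lemma emeasure_Z_eq_1:
  assumes lf: "AE \<omega> in M. linear_fractional (Q \<omega>)"
    and start: "AE \<omega> in M. Z 0 \<omega> = 1"
    and n: "n \<ge> 1"
  shows "emeasure M {\<omega> \<in> space M. Z n \<omega> = 1}
      = (\<integral>\<^sup>+e. ennreal (lf_slope e n) * ennreal (1 / (lf_comp e n 1)\<^sup>2) \<partial>(\<Pi>\<^sub>M i\<in>{1..n}. distr M Delta Q))"
proof -
  note [measurable] = Z_measurable
  let ?X = "\<lambda>\<omega>. \<lambda>i\<in>{1..n}. E i \<omega>"
  have X: "?X \<in> M \<rightarrow>\<^sub>M (\<Pi>\<^sub>M i\<in>{1..n}. Delta)"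
    using env_indep by (intro measurable_restrict) (auto simp: indep_vars_def)
  have "emeasure M {\<omega> \<in> space M. Z n \<omega> = 1} = (\<integral>\<^sup>+\<omega>. indicator {\<omega> \<in> space M. Z n \<omega> = 1} \<omega> \<partial>M)"
    by simp
  also have "\<dots> = (\<integral>\<^sup>+\<omega>. ennreal 1 * indicator {\<omega>. Z n \<omega> = 1} \<omega> \<partial>M)"
    by (intro nn_integral_cong) (auto simp: indicator_def)
  also have "\<dots> = (\<integral>\<^sup>+\<omega>. ennreal 1 * ennreal (pmf (quenched_law (environment E \<omega>) n) 1) \<partial>M)"
    by (rule nn_integral_quenched[OF start]) auto
  also have "\<dots> = (\<integral>\<^sup>+\<omega>. ennreal (lf_slope (?X \<omega>) n) * ennreal (1 / (lf_comp (?X \<omega>) n 1)\<^sup>2) \<partial>M)"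
  proof (rule nn_integral_cong_AE)
    have "AE \<omega> in M. \<forall>i\<in>{1..n}. linear_fractional (E i \<omega>)"
      using AE_linear_fractional_environment[OF lf] by (intro AE_ball_countable') auto
    then show "AE \<omega> in M. ennreal 1 * ennreal (pmf (quenched_law (environment E \<omega>) n) 1)
        = ennreal (lf_slope (?X \<omega>) n) * ennreal (1 / (lf_comp (?X \<omega>) n 1)\<^sup>2)"
    proof eventually_elim
      case (elim \<omega>)
      define e where "e = ?X \<omega>"
      have e: "environment E \<omega> i = e i" if "i \<in> {1..n}" for i
        using that by (simp add: environment_at e_def)
      have "pmf (quenched_law (environment E \<omega>) n) 1
          = lf_slope (environment E \<omega>) n / (lf_comp (environment E \<omega>) n 1)\<^sup>2"
        by (rule pmf_quenched_law_1) (use elim in \<open>auto simp: environment_at\<close>)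
      also have "\<dots> = lf_slope e n * (1 / (lf_comp e n 1)\<^sup>2)"
        using lf_slope_cong[OF e] lf_comp_cong[OF e] by simp
      finally show ?case
        unfolding e_def[symmetric] using lf_slope_pos[of e n] by (simp add: ennreal_mult'[symmetric])
    qed
  qed
  also have "\<dots> = (\<integral>\<^sup>+e. ennreal (lf_slope e n) * ennreal (1 / (lf_comp e n 1)\<^sup>2)
      \<partial>distr M (\<Pi>\<^sub>M i\<in>{1..n}. Delta) ?X)"
  proof -
    have [measurable]: "(\<lambda>e. lf_slope e n) \<in> borel_measurable (\<Pi>\<^sub>M i\<in>{1..n}. Delta)"
      "(\<lambda>e. lf_comp e n 1) \<in> borel_measurable (\<Pi>\<^sub>M i\<in>{1..n}. Delta)"
      by (auto intro: measurable_lf_slope measurable_lf_comp)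
    have "(\<lambda>e. ennreal (lf_slope e n) * ennreal (1 / (lf_comp e n 1)\<^sup>2))
        \<in> borel_measurable (distr M (\<Pi>\<^sub>M i\<in>{1..n}. Delta) ?X)"
      unfolding measurable_distr_eq1 by measurable
    from nn_integral_distr[OF X this] show ?thesis ..
  qed
  finally show ?thesis
    unfolding distr_environment_segment[OF n] .
qed

end

section \<open>Asymptotics of the probability of a single survivor\<close>

text \<open>Makes \<open>\<gamma>\<close> finite: outside \<open>[-1, 1]\<close> the function \<open>\<bar>x\<bar> exp (- x)\<close> dominates \<open>exp (- x)\<close>, and
  on this interval \<open>exp (- x)\<close> is bounded.\<close>

lemma exp_minus_le: "exp (- x) \<le> exp 1 + \<bar>x * exp (- x)\<bar>" for x :: real
proof (cases "\<bar>x\<bar> \<le> 1")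
  case True
  then have "exp (- x) \<le> exp 1" by simp
  then show ?thesis by linarith
next
  case False
  then have "1 * exp (- x) \<le> \<bar>x\<bar> * exp (- x)"
    by (intro mult_right_mono) auto
  moreover have "\<bar>x\<bar> * exp (- x) = \<bar>x * exp (- x)\<bar>"
    by (simp add: abs_mult)
  ultimately show ?thesis
    using exp_gt_zero[of 1] by linarith
qed

theorem theorem2p1p1:
  fixes M :: "'w measure"
    and Q :: "'w \<Rightarrow> nat pmf"
    and E :: "nat \<Rightarrow> 'w \<Rightarrow> nat pmf"
    and Z :: "nat \<Rightarrow> 'w \<Rightarrow> nat"
  assumes bpre: "branching_process_random_env M Q E Z"
    and lf: "AE \<omega> in M. linear_fractional (Q \<omega>)"
    and start: "AE \<omega> in M. Z 0 \<omega> = 1"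
    and super: "supercritical M Q"
    and XeX_integrable: "integrable M (\<lambda>\<omega>. log_mean (Q \<omega>) * exp (- log_mean (Q \<omega>)))"
    and XeX_pos: "0 < (\<integral>\<omega>. log_mean (Q \<omega>) * exp (- log_mean (Q \<omega>)) \<partial>M)"
    and log_moment: "integrable (tilted M Q) (\<lambda>\<omega>. ln (1 - pmf (Q \<omega>) 0))"
  shows "integrable M (\<lambda>\<omega>. exp (- log_mean (Q \<omega>))) \<and>
    (\<exists>\<theta>>0. (\<lambda>n. measure M {\<omega> \<in> space M. Z n \<omega> = 1}) \<sim>[at_top] (\<lambda>n. \<theta> * gamma_env M Q ^ n))"
proof -
  interpret branching_process_random_env M Q E Z by fact
  note [measurable] = Q_measurable
  define \<gamma> where "\<gamma> = gamma_env M Q"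
  have int: "integrable M (\<lambda>\<omega>. exp (- log_mean (Q \<omega>)))"
    by (rule Bochner_Integration.integrable_bound
        [of _ "\<lambda>\<omega>. exp 1 + \<bar>log_mean (Q \<omega>) * exp (- log_mean (Q \<omega>))\<bar>"])
      (use XeX_integrable in \<open>auto intro!: order_trans[OF exp_minus_le]\<close>)
  have \<gamma>: "0 < \<gamma>"
  proof -
    have "\<not> (AE \<omega> in M. exp (- log_mean (Q \<omega>)) = 0)"
      by (simp add: AE_False prob_space)
    then have "\<gamma> \<noteq> 0"
      unfolding \<gamma>_def gamma_env_def using int by (subst integral_nonneg_eq_0_iff_AE) auto
    moreover have "0 \<le> \<gamma>"
      by (simp add: \<gamma>_def gamma_env_def)
    ultimately show ?thesis by simp
  qed
  define D where "D = distr M Delta Q"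
  define N where "N = distr (tilted M Q) Delta Q"
  have tilted_eq: "tilted M Q = density M (\<lambda>\<omega>. ennreal (exp (- log_mean (Q \<omega>)) / \<gamma>))"
    by (simp add: tilted_def \<gamma>_def)
  have [measurable_cong]: "sets (tilted M Q) = sets M"
    by (simp add: tilted_eq)
  have tilt: "(\<integral>\<^sup>+q. ennreal (exp (- log_mean q)) * F q \<partial>D) = ennreal \<gamma> * (\<integral>\<^sup>+q. F q \<partial>N)"
    if [measurable]: "F \<in> borel_measurable Delta" for F
  proof -
    have "(\<integral>\<^sup>+q. F q \<partial>N) = (\<integral>\<^sup>+\<omega>. F (Q \<omega>) \<partial>tilted M Q)"
      unfolding N_def by (rule nn_integral_distr) measurable
    also have "\<dots> = (\<integral>\<^sup>+\<omega>. ennreal (exp (- log_mean (Q \<omega>)) / \<gamma>) * F (Q \<omega>) \<partial>M)"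
      unfolding tilted_eq by (rule nn_integral_density) measurable
    finally have "ennreal \<gamma> * (\<integral>\<^sup>+q. F q \<partial>N)
        = (\<integral>\<^sup>+\<omega>. ennreal \<gamma> * (ennreal (exp (- log_mean (Q \<omega>)) / \<gamma>) * F (Q \<omega>)) \<partial>M)"
      by (simp add: nn_integral_cmult)
    also have "\<dots> = (\<integral>\<^sup>+\<omega>. ennreal (exp (- log_mean (Q \<omega>))) * F (Q \<omega>) \<partial>M)"
      using \<gamma> by (simp add: mult.assoc[symmetric] ennreal_mult'[symmetric])
    also have "\<dots> = (\<integral>\<^sup>+q. ennreal (exp (- log_mean q)) * F q \<partial>D)"
      unfolding D_def by (rule nn_integral_distr[symmetric]) measurable
    finally show ?thesis ..
  qed
  have "prob_space (tilted M Q)"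
  proof (rule prob_spaceI)
    have "emeasure (tilted M Q) (space (tilted M Q)) = (\<integral>\<^sup>+\<omega>. ennreal (exp (- log_mean (Q \<omega>)) / \<gamma>) \<partial>M)"
      by (simp add: tilted_eq emeasure_density cong: nn_integral_cong)
    also have "\<dots> = ennreal (\<integral>\<omega>. exp (- log_mean (Q \<omega>)) / \<gamma> \<partial>M)"
      using int \<gamma> by (intro nn_integral_eq_integral) auto
    also have "(\<integral>\<omega>. exp (- log_mean (Q \<omega>)) / \<gamma> \<partial>M) = 1"
      using \<gamma> by (simp add: \<gamma>_def gamma_env_def)
    finally show "emeasure (tilted M Q) (space (tilted M Q)) = 1" by simp
  qed
  then interpret T: prob_space "tilted M Q" .
  have Q_T: "Q \<in> tilted M Q \<rightarrow>\<^sub>M Delta"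
    by measurable
  interpret N: lf_prob_space N
  proof (intro lf_prob_space.intro lf_prob_space_axioms.intro)
    show "prob_space N"
      unfolding N_def by (rule T.prob_space_distr[OF Q_T])
    show "sets N = sets Delta" by (simp add: N_def)
    have "AE \<omega> in tilted M Q. linear_fractional (Q \<omega>)"
      unfolding tilted_eq using lf by (subst AE_density) auto
    then show "AE q in N. linear_fractional q"
      unfolding N_def using Q_T by (subst AE_distr_iff) auto
  qed
  have int_X: "integrable N log_mean"
    using XeX_integrable \<gamma> unfolding N_def tilted_eq
    by (simp add: integrable_distr_eq integrable_density mult.commute)
  have "(\<integral>q. log_mean q \<partial>N) = (\<integral>\<omega>. log_mean (Q \<omega>) * exp (- log_mean (Q \<omega>)) \<partial>M) / \<gamma>"
    using \<gamma> unfolding N_def tilted_eq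
    by (simp add: integral_distr integral_density mult.commute)
  then have pos: "0 < (\<integral>q. log_mean q \<partial>N)"
    using XeX_pos \<gamma> by simp
  have int_ln: "integrable N (\<lambda>q. ln (1 - pmf q 0))"
    using log_moment Q_T unfolding N_def by (subst integrable_distr_eq) auto
  obtain b \<theta> where b: "\<And>n. (lf_op N ^^ n) (\<lambda>w. ennreal (1 / w\<^sup>2)) 1 = ennreal (b n)"
    "\<And>n. 0 \<le> b n" and \<theta>: "0 < \<theta>" "b \<longlonglongrightarrow> \<theta>"
    using N.funpow_lf_op_tendsto_pos[OF int_X int_ln pos] by metis
  have prob: "prob {\<omega> \<in> space M. Z n \<omega> = 1} = \<gamma> ^ n * b n" if "n \<ge> 1" for n
  proof -
    have "emeasure M {\<omega> \<in> space M. Z n \<omega> = 1}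
        = ennreal \<gamma> ^ n * (lf_op N ^^ n) (\<lambda>w. ennreal (1 / w\<^sup>2)) 1"
      unfolding emeasure_Z_eq_1[OF lf start that] D_def[symmetric]
    proof (rule nn_integral_PiM_lf_comp[OF _ _ _ tilt])
      show "prob_space D"
        unfolding D_def by (rule prob_space_distr) measurable
      show "lf_prob_space N" by unfold_locales
    qed (auto simp: D_def)
    also have "\<dots> = ennreal (\<gamma> ^ n * b n)"
      using \<gamma> b by (simp add: ennreal_power ennreal_mult)
    finally show ?thesis
      using \<gamma> b by (simp add: measure_def)
  qed
  have "((\<lambda>n. prob {\<omega> \<in> space M. Z n \<omega> = 1} / (\<theta> * \<gamma> ^ n)) \<longlongrightarrow> 1) at_top"
  proof (rule Lim_transform_eventually)
    have "(\<lambda>n. b n / \<theta>) \<longlonglongrightarrow> \<theta> / \<theta>"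
      using \<theta> by (intro tendsto_intros) auto
    then show "(\<lambda>n. b n / \<theta>) \<longlonglongrightarrow> 1"
      using \<theta> by simp
    show "\<forall>\<^sub>F n in sequentially. b n / \<theta> = prob {\<omega> \<in> space M. Z n \<omega> = 1} / (\<theta> * \<gamma> ^ n)"
      using eventually_ge_at_top[of 1] by eventually_elim (use \<gamma> in \<open>simp only: prob, simp\<close>)
  qed
  then have "(\<lambda>n. prob {\<omega> \<in> space M. Z n \<omega> = 1}) \<sim>[at_top] (\<lambda>n. \<theta> * \<gamma> ^ n)"
    using \<theta> \<gamma> by (intro asymp_equivI') auto
  with int \<theta> show ?thesis
    unfolding \<gamma>_def by blast
qed

end
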